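(* Let $\alpha\ge 0$ and $\beta\ge 0$ be real numbers, and let $f\in\mathcal{A}$ satisfy $f(z)f'(z)/z\neq 0$ for all $z\in\mathbb{D}$. If at least one of the following inequalities holds for all $z\in\mathbb{D}$: (i) $\operatorname{Re}\big(Q_{ST}(\alpha Q_{ST}+(1-\alpha)Q_{ST}^2+\beta Q_{SD})\big)>0$; (ii) $\operatorname{Re}\big(Q_{CV}(\alpha Q_{CV}+(1-\alpha)Q_{CV}^2+\beta Q_{SD})\big)>0$; (iii) $\operatorname{Re}\big(Q_{ST}(\alpha Q_{ST}+(1-\alpha)Q_{CV}^2+\beta Q_{SD})\big)>0$; (iv) $\operatorname{Re}\big(Q_{CV}(\alpha Q_{CV}+(1-\alpha)Q_{ST}^2+\beta Q_{SD})\big)>0$; then $f$ is starlike.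
   Context: $\mathbb{D}=\{z\in\mathbb{C}:|z|<1\}$. $\mathcal{A}$ is the class of analytic functions $f:\mathbb{D}\to\mathbb{C}$ with $f(0)=0$ and $f'(0)=1$. For $f\in\mathcal{A}$, as functions of $z\in\mathbb{D}$: $Q_{ST}=zf'(z)/f(z)$ (with the removable singularity at $z=0$ filled in, value $1$), $Q_{CV}=1+zf''(z)/f'(z)$, and $Q_{SD}=z^2\Big(\big(f''(z)/f'(z)\big)'-\tfrac12\big(f''(z)/f'(z)\big)^2\Big)$ ($z^2$ times the Schwarzian derivative of $f$). The condition $f(z)f'(z)/z\neq0$ is understood at $z=0$ via the removable singularity (where the value is $1$). A function $f\in\mathcal{A}$ is starlike if $\operatorname{Re}Q_{ST}>0$ on $\mathbb{D}$; equivalently, $f$ is univalent and $tf(z)\in f(\mathbb{D})$ for all $z\in\mathbb{D}$, $t\in[0,1]$. *)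

theory Defs
  imports "HOL-Complex_Analysis.Complex_Analysis"
begin

abbreviation unit_disc :: "complex set" where
  "unit_disc \<equiv> ball 0 1"

definition class_A :: "(complex \<Rightarrow> complex) set" where
  "class_A = {f. f holomorphic_on unit_disc \<and> f 0 = 0 \<and> deriv f 0 = 1}"

(* For f in class_A the quotient z f'(z) / f(z) has a removable singularity at 0
   with limit f'(0) / f'(0) = 1. *)
definition Q_ST :: "(complex \<Rightarrow> complex) \<Rightarrow> complex \<Rightarrow> complex" where
  "Q_ST f z = (if z = 0 then 1 else z * deriv f z / f z)"

definition Q_CV :: "(complex \<Rightarrow> complex) \<Rightarrow> complex \<Rightarrow> complex" where
  "Q_CV f z = 1 + z * deriv (deriv f) z / deriv f z"

definition schwarzian :: "(complex \<Rightarrow> complex) \<Rightarrow> complex \<Rightarrow> complex" where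
  "schwarzian f z =
     deriv (\<lambda>w. deriv (deriv f) w / deriv f w) z
       - 1 / 2 * (deriv (deriv f) z / deriv f z)\<^sup>2"

definition Q_SD :: "(complex \<Rightarrow> complex) \<Rightarrow> complex \<Rightarrow> complex" where
  "Q_SD f z = z\<^sup>2 * schwarzian f z"

(* The function f(z) f'(z) / z, whose removable singularity at 0 has the value
   f'(0)^2 = 1 for f in class_A. *)
definition ff'_over_z :: "(complex \<Rightarrow> complex) \<Rightarrow> complex \<Rightarrow> complex" where
  "ff'_over_z f z = (if z = 0 then 1 else f z * deriv f z / z)"

(* Starlikeness of a normalized function (HOL-Analysis.starlike is about sets).
   At a zero z of f with z in the disc and z different from 0, Q_ST f z = 0 by the
   convention x / 0 = 0, so such an f is not starlike. *)
definition starlike_function :: "(complex \<Rightarrow> complex) \<Rightarrow> bool" where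
  "starlike_function f \<longleftrightarrow> f \<in> class_A \<and> (\<forall>z\<in>unit_disc. Re (Q_ST f z) > 0)"

end

theory Submission
  imports Defs
begin

text \<open>Write $p = Q_{ST}$ and $q = Q_{CV}$. If $\mathrm{Re}\,p > 0$ fails somewhere, let $z$ be a
  point of least modulus with $\mathrm{Re}\,p(z) \le 0$. Then $\mathrm{Re}\,p \ge 0$ on the closed disc
  through $z$, with equality at $z$. Minimality along the circle gives $zp'(z) \in \mathbb{R}$ and
  $\mathrm{Re}(zp' + z^2p'') \le 0$ at $z$; minimality along the radius gives $zp'(z) \le 0$
  (lemma \<open>first_boundary_point\<close>).

  Logarithmic differentiation expresses everything through $p$: $q = p + zp'/p$ and
  $Q_{SD} = zq' + (1 - q^2)/2$. At $z$ the value $p$ is imaginary, and it is nonzero because $f'$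
  has no zeros; hence
  $q = kp$ with $k \ge 0$ real, and $p\,Q_{SD}$ differs from $zp' + z^2p''$ by an imaginary number.
  So for $X$ and $Y$ chosen freely from $p, q$, in the expression
  $X(\alpha X + (1-\alpha)Y^2 + \beta Q_{SD})$ the first term is a nonpositive real, the second is
  imaginary and the third has nonpositive real part (lemma \<open>Re_combination_le_0\<close>). The four
  choices of $(X, Y)$ are the four hypotheses, each of which is violated at $z$.\<close>

section \<open>The first point where the real part vanishes\<close>

text \<open>A negative second derivative would make \<open>g'\<close> negative just to the right of the critical
  point \<open>a\<close>, and by the mean value theorem \<open>g\<close> would drop below its minimum.\<close>

lemma second_derivative_nonneg_at_min:
  fixes g g' :: "real \<Rightarrow> real"
  assumes g: "\<And>t. (g has_real_derivative g' t) (at t)"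
    and g': "(g' has_real_derivative c) (at a)"
    and min: "\<And>t. g a \<le> g t"
  shows "g' a = 0" and "c \<ge> 0"
proof -
  show crit: "g' a = 0"
    using DERIV_local_min[OF g, of 1 a] min by simp
  show "c \<ge> 0"
  proof (rule ccontr)
    assume "\<not> c \<ge> 0"
    then obtain d where d: "d > 0" "\<And>h. h > 0 \<Longrightarrow> h < d \<Longrightarrow> g' (a + h) < g' a"
      using DERIV_neg_dec_right[OF g'] by force
    obtain z where z: "a < z" "z < a + d/2" "g (a + d/2) - g a = (a + d/2 - a) * g' z"
      using MVT2[of a "a + d/2" g g'] g d by auto
    have "g' z < 0" using d(2)[of "z - a"] z d crit by simp
    then have "g (a + d/2) - g a < 0"
      unfolding z(3) using d(1) by (intro mult_pos_neg) auto
    with min[of "a + d/2"] show False by simp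
  qed
qed

lemma has_real_derivative_Re_compose:
  assumes p: "p holomorphic_on S" "open S" and S: "\<gamma> (of_real t) \<in> S"
    and \<gamma>: "(\<gamma> has_field_derivative d) (at (of_real t))"
  shows "((\<lambda>t. Re (p (\<gamma> (of_real t)))) has_real_derivative Re (deriv p (\<gamma> (of_real t)) * d)) (at t)"
proof -
  have "(p has_field_derivative deriv p (\<gamma> (of_real t))) (at (\<gamma> (of_real t)))"
    using holomorphic_derivI[OF p S] .
  from DERIV_chain2[OF this \<gamma>]
  have "((\<lambda>t. p (\<gamma> (of_real t))) has_vector_derivative deriv p (\<gamma> (of_real t)) * d) (at t)"
    by (rule has_vector_derivative_real_field)
  from bounded_linear.has_vector_derivative[OF bounded_linear_Re this]
  show ?thesis by (simp add: has_real_derivative_iff_has_vector_derivative)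
qed

text \<open>On the circle through \<open>z\<close>, differentiation in the angle is the operator
  \<open>p \<mapsto> \<i> z p'\<close>; applying it twice yields the second-order condition.\<close>

lemma first_boundary_point:
  assumes p: "p holomorphic_on ball 0 R" and p0: "Re (p 0) > 0"
    and w: "w \<in> ball 0 R" "Re (p w) \<le> 0"
  obtains z where "z \<in> ball 0 R" "z \<noteq> 0" "Re (p z) = 0"
    "Im (z * deriv p z) = 0" "Re (z * deriv p z) \<le> 0"
    "Re (z * deriv p z + z\<^sup>2 * deriv (deriv p) z) \<le> 0"
proof -
  have cont: "continuous_on (ball 0 R) p"
    using p by (rule holomorphic_on_imp_continuous_on)
  define K where "K = cball 0 (norm w) \<inter> (\<lambda>z. Re (p z)) -` {..0}"
  have sub: "cball 0 (norm w) \<subseteq> ball 0 R" using w by auto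
  have "closed K"
    unfolding K_def
    by (intro continuous_closed_preimage continuous_on_Re continuous_on_subset[OF cont sub]) auto
  then have "compact K"
    by (simp add: compact_eq_bounded_closed K_def bounded_Int)
  moreover have "w \<in> K" using w by (simp add: K_def)
  ultimately obtain z where z: "z \<in> K" and least: "\<And>y. y \<in> K \<Longrightarrow> norm z \<le> norm y"
    using continuous_attains_inf[of K norm] by (auto intro: continuous_on_norm_id)
  have zw: "norm z \<le> norm w" and Rez: "Re (p z) \<le> 0" using z by (auto simp: K_def)
  have zR: "z \<in> ball 0 R" using zw w by simp
  have z0: "z \<noteq> 0" using Rez p0 by auto
  have pos: "Re (p y) > 0" if "norm y < norm z" for y
    using least[of y] that zw by (force simp: K_def)
  have sub': "cball 0 (norm z) \<subseteq> ball 0 R" using zR by auto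
  have nonneg: "Re (p y) \<ge> 0" if "norm y \<le> norm z" for y
  proof (rule continuous_ge_on_closure[of "ball 0 (norm z)" "\<lambda>y. Re (p y)"])
    show "continuous_on (closure (ball 0 (norm z))) (\<lambda>y. Re (p y))"
      using z0 by (auto intro!: continuous_intros continuous_on_subset[OF cont sub'])
    show "y \<in> closure (ball 0 (norm z))" using that z0 by simp
    show "\<And>x. x \<in> ball 0 (norm z) \<Longrightarrow> Re (p x) \<ge> 0" using pos less_imp_le by auto
  qed
  have Re0: "Re (p z) = 0" using nonneg[of z] Rez by simp

  define P where "P y = \<i> * y * deriv p y" for y
  have derp: "deriv p holomorphic_on ball 0 R" using p by (intro holomorphic_deriv) auto
  have P: "P holomorphic_on ball 0 R"
    unfolding P_def by (intro holomorphic_intros derp)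
  have rot: "((\<lambda>t. z * exp (\<i> * t)) has_field_derivative \<i> * (z * exp (\<i> * t))) (at t)" for t
    by (auto intro!: derivative_eq_intros)
  have circle: "z * exp (\<i> * of_real t) \<in> ball 0 R" for t :: real
    using zR by (simp add: norm_mult)
  have d1: "((\<lambda>t. Re (p (z * exp (\<i> * of_real t)))) has_real_derivative
              Re (P (z * exp (\<i> * of_real t)))) (at t)" for t :: real
    using has_real_derivative_Re_compose[OF p open_ball circle rot, of t]
    by (simp add: P_def mult_ac)
  have d2: "((\<lambda>t. Re (P (z * exp (\<i> * of_real t)))) has_real_derivative
              Re (\<i> * z * deriv P z)) (at 0)"
    using has_real_derivative_Re_compose[OF P open_ball circle rot, of 0]
    by (simp add: mult_ac)
  have "deriv P z = \<i> * (deriv p z + z * deriv (deriv p) z)"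
    unfolding P_def
    by (rule DERIV_imp_deriv)
      (auto intro!: derivative_eq_intros holomorphic_derivI[OF derp open_ball zR]
        simp: algebra_simps)
  then have dP: "\<i> * z * deriv P z = - (z * deriv p z + z\<^sup>2 * deriv (deriv p) z)"
    by (simp add: algebra_simps power2_eq_square)
  have min: "Re (p (z * exp (\<i> * of_real 0))) \<le> Re (p (z * exp (\<i> * of_real t)))" for t :: real
    using Re0 nonneg[of "z * exp (\<i> * of_real t)"] by (simp add: norm_mult)
  note angular = second_derivative_nonneg_at_min[OF d1 d2 min]
  have "Im (z * deriv p z) = 0"
    using angular(1) by (simp add: P_def algebra_simps)
  moreover have "Re (z * deriv p z + z\<^sup>2 * deriv (deriv p) z) \<le> 0"
    using angular(2) unfolding dP by simp
  moreover have "Re (z * deriv p z) \<le> 0"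
  proof (rule ccontr)
    \<comment> \<open>Otherwise the real part would be negative slightly inside the disc on the segment to \<open>0\<close>.\<close>
    assume pos_slope: "\<not> Re (z * deriv p z) \<le> 0"
    have "((\<lambda>t. t * z) has_field_derivative z) (at (of_real 1))"
      by (auto intro!: derivative_eq_intros)
    from has_real_derivative_Re_compose[OF p open_ball _ this] zR
    have "((\<lambda>t. Re (p (of_real t * z))) has_real_derivative Re (z * deriv p z)) (at 1)"
      by (simp add: mult_ac)
    from DERIV_pos_inc_left[OF this] pos_slope
    obtain d where "d > 0" and d: "\<And>h. h > 0 \<Longrightarrow> h < d \<Longrightarrow> Re (p (of_real (1 - h) * z)) < Re (p z)"
      by force
    \<comment> \<open>The bound by 1 keeps the point \<open>(1 - h) z\<close> on the segment from \<open>0\<close> to \<open>z\<close>.\<close>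
    define h where "h = min (d/2) 1"
    have h: "h > 0" "h < d" "h \<le> 1" using \<open>d > 0\<close> by (auto simp: h_def)
    have "norm (of_real (1 - h) * z) \<le> norm z"
      unfolding norm_mult norm_of_real using h by (intro mult_left_le_one_le) auto
    from nonneg[OF this] d[OF h(1,2)] Re0 show False by linarith
  qed
  ultimately show ?thesis using that zR z0 Re0 by blast
qed

text \<open>Since \<open>p\<close> is imaginary, odd powers of \<open>p\<close> with real coefficients are invisible to the real part:
  after expansion only the terms with \<open>p\<^sup>2 \<le> 0\<close> and with \<open>W\<close> remain. At the first boundary point
  \<open>X\<close> and \<open>Y\<close> stand for \<open>Q_ST\<close> or \<open>Q_CV\<close>, and \<open>D\<close> stands for \<open>Q_SD\<close>.\<close>

lemma Re_combination_le_0: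
  fixes p W :: complex and \<alpha> \<beta> x y d :: real
  assumes "Re p = 0" "p \<noteq> 0" "Re W \<le> 0" "\<alpha> \<ge> 0" "\<beta> \<ge> 0" "x \<ge> 0"
  defines "X \<equiv> of_real x * p" and "Y \<equiv> of_real y * p" and "D \<equiv> of_real d + W / p"
  shows "Re (X * (of_real \<alpha> * X + (1 - of_real \<alpha>) * Y\<^sup>2 + of_real \<beta> * D)) \<le> 0"
proof -
  obtain r where p: "p = \<i> * of_real r"
    using assms(1) by (metis complex_eq mult.commute of_real_0 add_0)
  have "X * (of_real \<alpha> * X + (1 - of_real \<alpha>) * Y\<^sup>2 + of_real \<beta> * D)
      = of_real (\<alpha> * x\<^sup>2) * p\<^sup>2 + of_real ((1 - \<alpha>) * x * y\<^sup>2) * p ^ 3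
        + of_real (\<beta> * x * d) * p + of_real (\<beta> * x) * W"
    using \<open>p \<noteq> 0\<close> unfolding X_def Y_def D_def
    by (simp add: field_simps power2_eq_square power3_eq_cube)
  also have "\<dots> = of_real (\<alpha> * x\<^sup>2) * of_real (- r\<^sup>2)
        + \<i> * of_real (\<beta> * x * d * r - (1 - \<alpha>) * x * y\<^sup>2 * r ^ 3) + of_real (\<beta> * x) * W"
    unfolding p by (simp add: algebra_simps power2_eq_square power3_eq_cube)
  also have "Re \<dots> = - (\<alpha> * x\<^sup>2 * r\<^sup>2) + \<beta> * x * Re W"
    by (simp del: of_real_mult of_real_minus of_real_diff of_real_power)
  also have "\<dots> \<le> 0"
  proof -
    have "\<beta> * x * Re W \<le> 0" "\<alpha> * x\<^sup>2 * r\<^sup>2 \<ge> 0"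
      using assms(3-6) by (auto intro!: mult_nonneg_nonpos mult_nonneg_nonneg)
    then show ?thesis by linarith
  qed
  finally show ?thesis .
qed

section \<open>Expressing Q_CV and Q_SD through Q_ST\<close>

lemma deriv_nonzero_of_ff'_over_z:
  assumes "f \<in> class_A" "\<forall>z\<in>unit_disc. ff'_over_z f z \<noteq> 0" "z \<in> unit_disc"
  shows "deriv f z \<noteq> 0" and "z \<noteq> 0 \<Longrightarrow> f z \<noteq> 0"
  using bspec[OF assms(2,3)] assms(1)
  by (auto simp: ff'_over_z_def class_A_def split: if_splits)

text \<open>\<open>Q_ST\<close> is the quotient of \<open>f'\<close> by the extension of \<open>f z / z\<close> over the origin, and this
  extension is holomorphic without zeros.\<close>

lemma Q_ST_holomorphic:
  assumes f: "f \<in> class_A" and nz: "\<forall>z\<in>unit_disc. ff'_over_z f z \<noteq> 0"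
  shows "Q_ST f holomorphic_on unit_disc"
proof -
  have hol: "f holomorphic_on unit_disc" and f0: "f 0 = 0" "deriv f 0 = 1"
    using f by (auto simp: class_A_def)
  define g where "g z = (if z = 0 then deriv f 0 else f z / z)" for z
  have g: "g holomorphic_on unit_disc"
    by (rule pole_theorem_open_0[OF hol open_ball, of 0]) (auto simp: g_def f0)
  have gnz: "g z \<noteq> 0" if "z \<in> unit_disc" for z
    using deriv_nonzero_of_ff'_over_z[OF f nz that] f0 by (auto simp: g_def)
  have "(\<lambda>z. deriv f z / g z) holomorphic_on unit_disc"
    using gnz by (intro holomorphic_intros g holomorphic_deriv hol open_ball)
  then show ?thesis
    by (rule holomorphic_transform) (auto simp: Q_ST_def g_def f0)
qed

text \<open>Differentiating \<open>Q_ST f z * f z = z * f' z\<close> and dividing by \<open>f'\<close> avoids logarithms; the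
  remaining factor \<open>f / f'\<close> equals \<open>z / Q_ST\<close>.\<close>

lemma Q_CV_eq_Q_ST:
  assumes f: "f \<in> class_A" and nz: "\<forall>z\<in>unit_disc. ff'_over_z f z \<noteq> 0"
    and z: "z \<in> unit_disc"
  shows "Q_CV f z = Q_ST f z + z * deriv (Q_ST f) z / Q_ST f z"
proof (cases "z = 0")
  case False
  have hol: "f holomorphic_on unit_disc" and f0: "f 0 = 0"
    using f by (auto simp: class_A_def)
  note nz' = deriv_nonzero_of_ff'_over_z[OF f nz z]
  note D = holomorphic_derivI[OF hol open_ball z]
    holomorphic_derivI[OF holomorphic_deriv[OF hol open_ball] open_ball z]
    holomorphic_derivI[OF Q_ST_holomorphic[OF f nz] open_ball z]
  have "((\<lambda>z. Q_ST f z * f z) has_field_derivative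
          Q_ST f z * deriv f z + deriv (Q_ST f) z * f z) (at z)"
    by (auto intro!: derivative_eq_intros D)
  moreover have "((\<lambda>z. Q_ST f z * f z) has_field_derivative
          deriv f z + z * deriv (deriv f) z) (at z)"
  proof (rule has_field_derivative_transform_within_open)
    show "((\<lambda>z. z * deriv f z) has_field_derivative
          deriv f z + z * deriv (deriv f) z) (at z)"
      by (auto intro!: derivative_eq_intros D)
    show "x * deriv f x = Q_ST f x * f x" if "x \<in> unit_disc" for x
      using deriv_nonzero_of_ff'_over_z[OF f nz that] f0 by (auto simp: Q_ST_def)
  qed (use z in auto)
  ultimately have "Q_ST f z * deriv f z + deriv (Q_ST f) z * f z
      = deriv f z + z * deriv (deriv f) z"
    by (rule DERIV_unique)
  then have "Q_ST f z + deriv (Q_ST f) z * (f z / deriv f z) = Q_CV f z"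
    using nz' by (simp add: Q_CV_def field_simps)
  moreover have "f z / deriv f z = z / Q_ST f z"
    using False nz' by (simp add: Q_ST_def)
  ultimately show ?thesis by (simp add: mult_ac)
qed (simp add: Q_CV_def Q_ST_def)

text \<open>In terms of \<open>h = f'' / f'\<close> one has \<open>Q_CV = 1 + z h\<close>, so \<open>z Q_CV' = z h + z\<^sup>2 h'\<close>, and completing
  the square absorbs the term \<open>z h\<close>.\<close>

lemma Q_SD_eq_Q_CV:
  assumes f: "f holomorphic_on unit_disc" and nz: "deriv f z \<noteq> 0" and z: "z \<in> unit_disc"
  shows "Q_SD f z = z * deriv (Q_CV f) z + (1 - (Q_CV f z)\<^sup>2) / 2"
proof -
  define h where "h w = deriv (deriv f) w / deriv f w" for w
  have hol': "deriv f holomorphic_on unit_disc" "deriv (deriv f) holomorphic_on unit_disc"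
    using f by (auto intro!: holomorphic_deriv)
  have "h field_differentiable at z"
    unfolding h_def using nz z hol'
    by (intro field_differentiable_divide) (auto simp: holomorphic_on_open field_differentiable_def)
  then have Dh: "(h has_field_derivative deriv h z) (at z)"
    by (rule field_differentiable_derivI)
  have "Q_CV f = (\<lambda>w. 1 + w * h w)" by (auto simp: Q_CV_def h_def)
  moreover have "((\<lambda>w. 1 + w * h w) has_field_derivative h z + z * deriv h z) (at z)"
    by (auto intro!: derivative_eq_intros Dh)
  ultimately have "deriv (Q_CV f) z = h z + z * deriv h z" "Q_CV f z = 1 + z * h z"
    by (simp_all add: DERIV_imp_deriv)
  moreover have "Q_SD f z = z\<^sup>2 * (deriv h z - 1/2 * (h z)\<^sup>2)"
    by (simp add: Q_SD_def schwarzian_def h_def[abs_def])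
  ultimately show ?thesis by (simp add: field_simps power2_eq_square)
qed

text \<open>The summands are grouped so that at the first boundary point all of them are real except
  the last, whose numerator is the quantity controlled by the second-order condition.\<close>

lemma Q_SD_eq_Q_ST:
  assumes f: "f \<in> class_A" and nz: "\<forall>z\<in>unit_disc. ff'_over_z f z \<noteq> 0"
    and z: "z \<in> unit_disc" and pz: "Q_ST f z \<noteq> 0"
  defines "p \<equiv> Q_ST f"
  shows "Q_SD f z = z * deriv p z - (z * deriv p z / p z)\<^sup>2 + (1 - (Q_CV f z)\<^sup>2) / 2
           + (z * deriv p z + z\<^sup>2 * deriv (deriv p) z) / p z"
proof -
  have p: "p holomorphic_on unit_disc" unfolding p_def by (rule Q_ST_holomorphic[OF f nz])
  note D = holomorphic_derivI[OF p open_ball z]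
    holomorphic_derivI[OF holomorphic_deriv[OF p open_ball] open_ball z]
  have pz': "p z \<noteq> 0" using pz by (simp add: p_def)
  have "(Q_CV f has_field_derivative
      deriv p z + ((deriv p z + z * deriv (deriv p) z) / p z - z * (deriv p z)\<^sup>2 / (p z)\<^sup>2)) (at z)"
  proof (rule has_field_derivative_transform_within_open)
    show "((\<lambda>z. p z + z * deriv p z / p z) has_field_derivative
      deriv p z + ((deriv p z + z * deriv (deriv p) z) / p z - z * (deriv p z)\<^sup>2 / (p z)\<^sup>2)) (at z)"
      using pz' by (auto intro!: derivative_eq_intros D simp: field_simps power2_eq_square)
    show "p x + x * deriv p x / p x = Q_CV f x" if "x \<in> unit_disc" for x
      using Q_CV_eq_Q_ST[OF f nz that] by (simp add: p_def)
  qed (use z in auto)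
  then have Q_CV': "deriv (Q_CV f) z =
      deriv p z + ((deriv p z + z * deriv (deriv p) z) / p z - z * (deriv p z)\<^sup>2 / (p z)\<^sup>2)"
    by (rule DERIV_imp_deriv)
  have "z * deriv (Q_CV f) z = z * deriv p z - (z * deriv p z / p z)\<^sup>2
           + (z * deriv p z + z\<^sup>2 * deriv (deriv p) z) / p z"
    unfolding Q_CV' using pz' by (simp add: field_simps power2_eq_square)
  moreover have "Q_SD f z = z * deriv (Q_CV f) z + (1 - (Q_CV f z)\<^sup>2) / 2"
    using f deriv_nonzero_of_ff'_over_z(1)[OF f nz z] z
    by (intro Q_SD_eq_Q_CV) (auto simp: class_A_def)
  ultimately show ?thesis by simp
qed

section \<open>Starlikeness\<close>

theorem theorem2p4:
  fixes \<alpha> \<beta> :: real and f :: "complex \<Rightarrow> complex"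
  assumes "\<alpha> \<ge> 0" and "\<beta> \<ge> 0"
    and "f \<in> class_A"
    and "\<forall>z\<in>unit_disc. ff'_over_z f z \<noteq> 0"
    and "(\<forall>z\<in>unit_disc. Re (Q_ST f z * (of_real \<alpha> * Q_ST f z
              + (1 - of_real \<alpha>) * (Q_ST f z)\<^sup>2 + of_real \<beta> * Q_SD f z)) > 0)
       \<or> (\<forall>z\<in>unit_disc. Re (Q_CV f z * (of_real \<alpha> * Q_CV f z
              + (1 - of_real \<alpha>) * (Q_CV f z)\<^sup>2 + of_real \<beta> * Q_SD f z)) > 0)
       \<or> (\<forall>z\<in>unit_disc. Re (Q_ST f z * (of_real \<alpha> * Q_ST f z
              + (1 - of_real \<alpha>) * (Q_CV f z)\<^sup>2 + of_real \<beta> * Q_SD f z)) > 0)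
       \<or> (\<forall>z\<in>unit_disc. Re (Q_CV f z * (of_real \<alpha> * Q_CV f z
              + (1 - of_real \<alpha>) * (Q_ST f z)\<^sup>2 + of_real \<beta> * Q_SD f z)) > 0)"
  shows "starlike_function f"
proof (rule ccontr)
  assume "\<not> starlike_function f"
  then obtain w where "w \<in> unit_disc" "Re (Q_ST f w) \<le> 0"
    using assms(3) by (auto simp: starlike_function_def not_less)
  moreover have "Re (Q_ST f 0) > 0" by (simp add: Q_ST_def)
  ultimately obtain z where z: "z \<in> unit_disc" "z \<noteq> 0" and Re0: "Re (Q_ST f z) = 0"
    and der: "Im (z * deriv (Q_ST f) z) = 0" "Re (z * deriv (Q_ST f) z) \<le> 0"
      "Re (z * deriv (Q_ST f) z + z\<^sup>2 * deriv (deriv (Q_ST f)) z) \<le> 0"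
    using first_boundary_point[OF Q_ST_holomorphic[OF assms(3,4)]] by metis
  define p W where "p = Q_ST f z"
    and "W = z * deriv (Q_ST f) z + z\<^sup>2 * deriv (deriv (Q_ST f)) z"
  define s r where "s = Re (z * deriv (Q_ST f) z)" and "r = Im p"
  \<comment> \<open>\<open>p = \<i> r\<close> and \<open>z p' = s\<close>; \<open>k\<close> is the quotient \<open>Q_CV / Q_ST = 1 + s / p\<^sup>2\<close>, and \<open>d\<close> collects the
    real summands of \<open>Q_SD\<close>.\<close>
  define k where "k = 1 - s / r\<^sup>2"
  define d where "d = s + s\<^sup>2 / r\<^sup>2 + (1 + (k * r)\<^sup>2) / 2"
  have p0: "p \<noteq> 0"
    using deriv_nonzero_of_ff'_over_z[OF assms(3,4) z(1)] z(2) by (simp add: p_def Q_ST_def)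
  have s: "z * deriv (Q_ST f) z = of_real s"
    using der(1) by (simp add: s_def complex_eq_iff)
  have p2: "p\<^sup>2 = - of_real (r\<^sup>2)"
    using Re0 by (simp add: p_def r_def complex_eq_iff power2_eq_square)
  have r0: "r \<noteq> 0" using p0 p2 by auto
  have k: "k \<ge> 0"
    using der(2) by (simp add: k_def s_def divide_nonpos_nonneg order_trans[of _ 0 1])
  have inv: "of_real s / p = - of_real (s / r\<^sup>2) * p"
  proof -
    have "of_real s / p = of_real s * p / p\<^sup>2"
      using p0 by (simp add: power2_eq_square)
    then show ?thesis by (simp add: p2)
  qed
  have CV: "Q_CV f z = of_real k * p"
    using Q_CV_eq_Q_ST[OF assms(3,4) z(1)] inv unfolding s p_def[symmetric] k_def
    by (simp add: algebra_simps)
  have "(of_real s / p)\<^sup>2 = - of_real (s\<^sup>2 / r\<^sup>2)"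
    by (simp add: power_divide p2)
  moreover have "(Q_CV f z)\<^sup>2 = - of_real ((k * r)\<^sup>2)"
    unfolding CV by (simp add: power_mult_distrib p2)
  ultimately have SD: "Q_SD f z = of_real d + W / p"
    using Q_SD_eq_Q_ST[OF assms(3,4) z(1)] p0
    unfolding W_def[symmetric] unfolding s p_def[symmetric] d_def by simp
  have ST: "Q_ST f z = of_real 1 * p" by (simp add: p_def)
  have neg: "Re (of_real x * p * (of_real \<alpha> * (of_real x * p)
      + (1 - of_real \<alpha>) * (of_real y * p)\<^sup>2 + of_real \<beta> * (of_real d + W / p))) \<le> 0"
    if "x \<ge> 0" for x y
    using Re_combination_le_0[of p W \<alpha> \<beta> x] Re0 p0 der(3) assms(1,2) that
    by (simp add: p_def W_def)
  \<comment> \<open>\<open>Q_ST\<close> and \<open>Q_CV\<close> are the multiples of \<open>p\<close> by \<open>1\<close> and \<open>k\<close>.\<close>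
  show False
    using assms(5) z(1) neg[of 1 1] neg[of k k] neg[of 1 k] neg[of k 1] k
    unfolding ST[symmetric] CV[symmetric] SD[symmetric]
    by (meson zero_le_one not_less)
qed

end
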